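(* Let $\mathcal B$ and $\mathcal B'$ be blockchains and let $tx$ be a transaction. (1) If $\mathcal B\cong\mathcal B'$, $\mathrm{valid}(\mathcal B;tx)$ and $\mathrm{valid}(\mathcal B';tx)$, then $\mathcal B;tx\cong\mathcal B';tx$. (2) If $\mathcal B=_\alpha\mathcal B'$ then $\mathcal B\cong\mathcal B'$. (3) Up to $\alpha$-equivalence, if $\mathcal B\cong\mathcal B'$ then $\mathrm{valid}(\mathcal B;tx)\Longleftrightarrow\mathrm{valid}(\mathcal B';tx)$. That is, there exist blockchains $\mathcal B_1=_\alpha\mathcal B$ and $\mathcal B_1'=_\alpha\mathcal B'$ such that, if $\mathcal B_1\cong\mathcal B_1'$, then $\mathrm{valid}(\mathcal B_1;tx)\Longleftrightarrow\mathrm{valid}(\mathcal B_1';tx)$. (4) Up to $\alpha$-equivalence, if $\mathcal B\cong\mathcal B'$ and $\mathrm{valid}(\mathcal B;tx)$ then $\mathcal B;tx\cong\mathcal B';tx$. That is, there exist blockchains $\mathcal B_1=_\alpha\mathcal B$ and $\mathcal B_1'=_\alpha\mathcal B'$ such that, if $\mathcal B_1\cong\mathcal B_1'$ and $\mathrm{valid}(\mathcal B_1;tx)$, then $\mathcal B_1;tx\cong\mathcal B_1';tx$.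
   Context: Idealised EUTxO. Fix a solution of the following type equations (the choice of the subset $\mathsf{Validator}$ is left unspecified): $\mathsf{Redeemer}=\mathsf{CurrencySymbol}=\mathsf{TokenName}=\mathsf{Position}=\mathbb N$; $\mathsf{Chip}=\mathsf{CurrencySymbol}\times\mathsf{TokenName}$; $\mathsf{Datum}=\mathbb N$; $\mathsf{Value}$ is the set of finite partial functions from $\mathsf{Chip}$ to $\mathbb N_{>0}$; $\mathsf{Validator}\subseteq \mathcal P(\mathsf{Redeemer}\times\mathsf{Datum}\times\mathsf{Value}\times\mathsf{Context})$, where $\mathcal P$ is powerset; $\mathsf{Input}=\mathsf{Position}\times\mathsf{Redeemer}$; $\mathsf{Output}=\mathsf{Position}\times\mathsf{Validator}\times\mathsf{Datum}\times\mathsf{Value}$; $\mathsf{Transaction}$ is the set of pairs $(I,O)$ with $I$ a finite subset of $\mathsf{Input}$ and $O$ a finite subset of $\mathsf{Output}$ (either may be empty); $\mathsf{Context}$ is the set of $((I,i),O)$ with $(I,O)\in\mathsf{Transaction}$ and $i\in I$. If $tx=(I,O)$ is a transaction and $i\in I$, write $tx@i$ for the context $((I,i),O)$. An input $i$ points to an output $o$ when $i$ and $o$ have the same position (first component). $\mathit{Txs}$ ranges over finite sequences of transactions; inputs and outputs appearing in $\mathit{Txs}$ are understood as occurrences (in a given transaction of the sequence), and "earlier"/"later" refer to strictly earlier/later transactions in the sequence. A (valid) blockchain is a finite sequence of transactions $\mathit{Txs}$ such that: (i) distinct outputs appearing in $\mathit{Txs}$ have distinct positions; (ii) every input $i$ in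 some $tx$ in $\mathit{Txs}$ points to a unique output, denoted $\mathit{Txs}(i)$, in some earlier transaction, and distinct inputs appearing in $\mathit{Txs}$ have distinct positions; (iii) if an input $i=(p,k)$ appears in $tx$ in $\mathit{Txs}$ and points to the earlier output $\mathit{Txs}(i)=(p,V,s,v)$, then $(k,s,v,tx@i)\in V$. Write $\mathrm{valid}(\mathit{Txs})$ for "$\mathit{Txs}$ is a blockchain". The symbol $;$ denotes concatenation of sequences of transactions (a single transaction being treated as a one-element sequence). For any finite sequence of transactions $\mathit{Txs}$, an output appearing in $\mathit{Txs}$ is spent (in $\mathit{Txs}$) when a later input points to it, and otherwise unspent. $\mathrm{UTxO}(\mathit{Txs})$ is the set of unspent outputs in $\mathit{Txs}$. Write $\mathit{Txs}\cong\mathit{Txs}'$ (observational equivalence) when $\mathrm{UTxO}(\mathit{Txs})=\mathrm{UTxO}(\mathit{Txs}')$. $\alpha$-equivalence: for blockchains, $\mathcal B=_\alpha\mathcal B'$ when $\mathcal B$ and $\mathcal B'$ differ only in their choice of positions of spent output-input pairs; i.e. $\mathcal B'$ is obtained from $\mathcal B$ by applying to the position component of every input and output appearing in $\mathcal B$ a permutation of $\mathbb N$ that fixes the positions of all unspent outputs of $\mathcal B$ (redeemers, validators, data and values are unchanged). This is an equivalence relation. Standing assumption: the choice of position of a spent output-input pair is irrelevant, i.e. renaming positions in a blockchain in the manner just described again yields a blockchain. "Up to $\alpha$-equivalence, $\Phi$" means: there exist $\alpha$-equivalent forms of the (blockchain) arguments of $\Phi$ such that $\Phi$ is true of those arguments.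 *)

theory Defs
  imports Main
begin

type_synonym redeemer = nat
type_synonym currency_symbol = nat
type_synonym token_name = nat
type_synonym position = nat
type_synonym datum = nat
type_synonym chip = "currency_symbol \<times> token_name"
type_synonym chip_value = "chip \<rightharpoonup> nat"
type_synonym tx_input = "position \<times> redeemer"
type_synonym 'v tx_output = "position \<times> 'v \<times> datum \<times> chip_value"
type_synonym 'v transaction = "tx_input set \<times> 'v tx_output set"
type_synonym 'v tx_context = "(tx_input set \<times> tx_input) \<times> 'v tx_output set"

text \<open>The HOL types above only give the shape of the objects; the sets below impose
  finiteness, positivity of values, and membership in the chosen set \<open>Vs\<close> of validators.\<close>

definition Values :: "chip_value set" where
  "Values = {v. finite (dom v) \<and> (\<forall>n\<in>ran v. 0 < n)}"

definition Outputs :: "'v set \<Rightarrow> 'v tx_output set" where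
  "Outputs Vs = UNIV \<times> Vs \<times> UNIV \<times> Values"

definition Transactions :: "'v set \<Rightarrow> 'v transaction set" where
  "Transactions Vs = {(I, Os). finite I \<and> finite Os \<and> Os \<subseteq> Outputs Vs}"

definition Contexts :: "'v set \<Rightarrow> 'v tx_context set" where
  "Contexts Vs = {((I, i), Os). (I, Os) \<in> Transactions Vs \<and> i \<in> I}"

text \<open>Contexts contain validators, and validators are sets of tuples containing contexts.
  This circularity is resolved by taking validators to be elements of a set \<open>Vs\<close> of an arbitrary
  type, where the injection \<open>den\<close> identifies each of them with an actual set of tuples; so \<open>Vs\<close>
  is, up to this identification, an arbitrary (possibly empty) subset of the powerset of
  Redeemer \<open>\<times>\<close> Datum \<open>\<times>\<close> Value \<open>\<times>\<close> Context.\<close>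

definition eutxo_solution ::
  "'v set \<Rightarrow> ('v \<Rightarrow> (redeemer \<times> datum \<times> chip_value \<times> 'v tx_context) set) \<Rightarrow> bool" where
  "eutxo_solution Vs den \<longleftrightarrow>
     inj_on den Vs \<and> den ` Vs \<subseteq> Pow (UNIV \<times> UNIV \<times> Values \<times> Contexts Vs)"

definition tx_at :: "'v transaction \<Rightarrow> tx_input \<Rightarrow> 'v tx_context" where
  "tx_at tx i = ((fst tx, i), snd tx)"

definition points_to :: "tx_input \<Rightarrow> 'v tx_output \<Rightarrow> bool" where
  "points_to i out \<longleftrightarrow> fst i = fst out"

text \<open>Occurrences: an input or output together with the index of the transaction it appears in.\<close>

definition input_occs :: "'v transaction list \<Rightarrow> (nat \<times> tx_input) set" where
  "input_occs Txs = {(n, i). n < length Txs \<and> i \<in> fst (Txs ! n)}"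

definition output_occs :: "'v transaction list \<Rightarrow> (nat \<times> 'v tx_output) set" where
  "output_occs Txs = {(n, out). n < length Txs \<and> out \<in> snd (Txs ! n)}"

definition blockchain ::
  "'v set \<Rightarrow> ('v \<Rightarrow> (redeemer \<times> datum \<times> chip_value \<times> 'v tx_context) set)
    \<Rightarrow> 'v transaction list \<Rightarrow> bool" where
  "blockchain Vs den Txs \<longleftrightarrow>
     set Txs \<subseteq> Transactions Vs \<and>
     inj_on (\<lambda>(m, out). fst out) (output_occs Txs) \<and>
     (\<forall>(n, i)\<in>input_occs Txs. \<exists>!r. r \<in> output_occs Txs \<and> fst r < n \<and> points_to i (snd r)) \<and>
     inj_on (\<lambda>(n, i). fst i) (input_occs Txs) \<and>
     (\<forall>n p k m V s v.
        (n, (p, k)) \<in> input_occs Txs \<and> (m, (p, V, s, v)) \<in> output_occs Txs \<and> m < n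
        \<longrightarrow> (k, s, v, tx_at (Txs ! n) (p, k)) \<in> den V)"

definition spent :: "'v transaction list \<Rightarrow> nat \<times> 'v tx_output \<Rightarrow> bool" where
  "spent Txs = (\<lambda>(m, out). \<exists>(n, i)\<in>input_occs Txs. m < n \<and> points_to i out)"

text \<open>The index of the occurrence is forgotten here, since UTxO sets of sequences of different
  shapes have to be compared.\<close>

definition UTxO :: "'v transaction list \<Rightarrow> 'v tx_output set" where
  "UTxO Txs = {out. \<exists>m. (m, out) \<in> output_occs Txs \<and> \<not> spent Txs (m, out)}"

definition obs_equiv :: "'v transaction list \<Rightarrow> 'v transaction list \<Rightarrow> bool"
    (infix "\<cong>\<^sub>U" 50) where
  "Txs \<cong>\<^sub>U Txs' \<longleftrightarrow> UTxO Txs = UTxO Txs'"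

definition rename_tx :: "(position \<Rightarrow> position) \<Rightarrow> 'v transaction \<Rightarrow> 'v transaction" where
  "rename_tx \<pi> tx = (apfst \<pi> ` fst tx, apfst \<pi> ` snd tx)"

definition rename :: "(position \<Rightarrow> position) \<Rightarrow> 'v transaction list \<Rightarrow> 'v transaction list" where
  "rename \<pi> Txs = map (rename_tx \<pi>) Txs"

definition spent_renaming :: "'v transaction list \<Rightarrow> (position \<Rightarrow> position) \<Rightarrow> bool" where
  "spent_renaming B \<pi> \<longleftrightarrow> bij \<pi> \<and> (\<forall>out\<in>UTxO B. \<pi> (fst out) = fst out)"

definition alpha_equiv ::
  "'v set \<Rightarrow> ('v \<Rightarrow> (redeemer \<times> datum \<times> chip_value \<times> 'v tx_context) set)
    \<Rightarrow> 'v transaction list \<Rightarrow> 'v transaction list \<Rightarrow> bool" where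
  "alpha_equiv Vs den B B' \<longleftrightarrow>
     blockchain Vs den B \<and> blockchain Vs den B' \<and> (\<exists>\<pi>. spent_renaming B \<pi> \<and> B' = rename \<pi> B)"

text \<open>Validators may inspect the positions in the context they are given, so the following is a
  genuine condition on the solution \<open>(Vs, den)\<close>.\<close>

definition spent_positions_irrelevant ::
  "'v set \<Rightarrow> ('v \<Rightarrow> (redeemer \<times> datum \<times> chip_value \<times> 'v tx_context) set) \<Rightarrow> bool" where
  "spent_positions_irrelevant Vs den \<longleftrightarrow>
     (\<forall>B \<pi>. blockchain Vs den B \<and> spent_renaming B \<pi> \<longrightarrow> blockchain Vs den (rename \<pi> B))"

end

theory Submission
  imports Defs
begin

text \<open>The unspent outputs of \<open>B;tx\<close> are the outputs of \<open>tx\<close> together with the unspent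
  outputs of \<open>B\<close> to which no input of \<open>tx\<close> points, so \<open>UTxO (B;tx)\<close> depends on \<open>B\<close> only through
  \<open>UTxO B\<close>; this gives (1) and (4). For (3), the validity of \<open>B;tx\<close> depends on the spent positions
  of \<open>B\<close> only in that they may clash with the positions in \<open>tx\<close>. Renaming the spent positions
  of both chains away from those in \<open>tx\<close> removes the clashes.\<close>

section \<open>Positions, and the effect of appending a transaction\<close>

text \<open>In a blockchain these are exactly the positions of the spent outputs, since every input
  points to an earlier output; they are the ones to be renamed away from \<open>tx\<close>.\<close>

definition input_positions :: "'v transaction list \<Rightarrow> position set" where
  "input_positions Txs = (\<lambda>(n, i). fst i) ` input_occs Txs"

definition tx_positions :: "'v transaction \<Rightarrow> position set" where
  "tx_positions tx = fst ` fst tx \<union> fst ` snd tx"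

lemma input_positions_eq: "input_positions Txs = fst ` (\<Union>tx\<in>set Txs. fst tx)"
  by (force simp: input_positions_def input_occs_def in_set_conv_nth image_iff)

lemma input_occs_less: "(n, i) \<in> input_occs Txs \<Longrightarrow> n < length Txs"
  by (simp add: input_occs_def)

lemma output_occs_less: "(n, out) \<in> output_occs Txs \<Longrightarrow> n < length Txs"
  by (simp add: output_occs_def)

lemma input_occs_snoc: "input_occs (Txs @ [tx]) = input_occs Txs \<union> {length Txs} \<times> fst tx"
  by (auto simp: input_occs_def nth_append less_Suc_eq)

lemma output_occs_snoc: "output_occs (Txs @ [tx]) = output_occs Txs \<union> {length Txs} \<times> snd tx"
  by (auto simp: output_occs_def nth_append less_Suc_eq)

text \<open>Spending needs a strictly later input, so the inputs of \<open>tx\<close> can only spend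
  outputs of \<open>Txs\<close>, and nothing follows that could spend the outputs of
  \<open>tx\<close>. This holds for arbitrary sequences, valid or not.\<close>

lemma UTxO_snoc:
  "UTxO (Txs @ [tx]) = {out \<in> UTxO Txs. \<forall>i\<in>fst tx. \<not> points_to i out} \<union> snd tx"
proof -
  have spent_old: "spent (Txs @ [tx]) (m, out) \<longleftrightarrow> spent Txs (m, out) \<or> (\<exists>i\<in>fst tx. points_to i out)"
    if "m < length Txs" for m out
    using that by (auto simp: spent_def input_occs_snoc)
  have spent_new: "\<not> spent (Txs @ [tx]) (length Txs, out)" for out
    by (auto simp: spent_def input_occs_snoc dest: input_occs_less)
  have "(m, out) \<in> output_occs (Txs @ [tx]) \<and> \<not> spent (Txs @ [tx]) (m, out) \<longleftrightarrow>
      (m, out) \<in> output_occs Txs \<and> \<not> spent Txs (m, out) \<and> (\<forall>i\<in>fst tx. \<not> points_to i out) \<or>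
      m = length Txs \<and> out \<in> snd tx" for m out
    using output_occs_less[of m out Txs] by (auto simp: output_occs_snoc spent_old spent_new)
  then show ?thesis
    unfolding UTxO_def by blast
qed

lemma obs_equiv_snoc: "Txs \<cong>\<^sub>U Txs' \<Longrightarrow> Txs @ [tx] \<cong>\<^sub>U Txs' @ [tx]"
  by (simp add: obs_equiv_def UTxO_snoc)

section \<open>Renaming of positions\<close>

lemma input_occs_rename: "input_occs (rename \<pi> Txs) = apsnd (apfst \<pi>) ` input_occs Txs"
  by (force simp: input_occs_def rename_def rename_tx_def image_iff)

lemma output_occs_rename: "output_occs (rename \<pi> Txs) = apsnd (apfst \<pi>) ` output_occs Txs"
  by (force simp: output_occs_def rename_def rename_tx_def image_iff)

text \<open>An injective renaming neither merges nor separates positions, so it preserves and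
  reflects \<open>points_to\<close>.\<close>

lemma spent_rename:
  assumes "inj \<pi>"
  shows "spent (rename \<pi> Txs) (m, apfst \<pi> out) \<longleftrightarrow> spent Txs (m, out)"
  using assms
  by (force simp: spent_def input_occs_rename points_to_def inj_eq)

lemma UTxO_rename:
  assumes "inj \<pi>"
  shows "UTxO (rename \<pi> Txs) = apfst \<pi> ` UTxO Txs"
  using spent_rename[OF assms, of Txs]
  by (force simp: UTxO_def output_occs_rename image_iff)

text \<open>Renaming maps unspent outputs to unspent outputs, and \<open>\<pi>\<close> fixes the
  position of each of them; this yields (2).\<close>

lemma UTxO_spent_renaming:
  assumes "spent_renaming B \<pi>"
  shows "UTxO (rename \<pi> B) = UTxO B"
proof -
  have "apfst \<pi> out = out" if "out \<in> UTxO B" for out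
    using assms that by (cases out) (auto simp: spent_renaming_def)
  then show ?thesis
    using assms by (simp add: UTxO_rename spent_renaming_def bij_is_inj)
qed

lemma alpha_equiv_imp_obs_equiv: "alpha_equiv Vs den B B' \<Longrightarrow> B \<cong>\<^sub>U B'"
  by (auto simp: alpha_equiv_def obs_equiv_def UTxO_spent_renaming)

lemma input_positions_rename: "input_positions (rename \<pi> Txs) = \<pi> ` input_positions Txs"
  by (force simp: input_positions_def input_occs_rename image_iff)

lemma rename_rename:
  assumes "\<And>x. \<pi> (\<sigma> x) = x"
  shows "rename \<pi> (rename \<sigma> Txs) = Txs"
proof -
  have "\<pi> \<circ> \<sigma> = id"
    using assms by (simp add: fun_eq_iff)
  then show ?thesis
    by (simp add: rename_def rename_tx_def image_image apfst_compose o_def)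
qed

section \<open>Moving spent positions away from a finite set\<close>

lemma finite_input_positions:
  assumes "set Txs \<subseteq> Transactions Vs"
  shows "finite (input_positions Txs)"
  unfolding input_positions_eq
  using assms by (intro finite_imageI finite_UN_I) (auto simp: Transactions_def)

lemma finite_UTxO:
  assumes "set Txs \<subseteq> Transactions Vs"
  shows "finite (UTxO Txs)"
proof (rule finite_subset)
  show "UTxO Txs \<subseteq> (\<Union>tx\<in>set Txs. snd tx)"
    by (force simp: UTxO_def output_occs_def)
  show "finite (\<Union>tx\<in>set Txs. snd tx)"
    using assms by (auto simp: Transactions_def)
qed

text \<open>The output an input points to is the only one at its position, because output positions
  are distinct, and that output is spent.\<close>

lemma input_positions_disjoint_UTxO:
  assumes "blockchain Vs den B"
  shows "input_positions B \<inter> fst ` UTxO B = {}"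
proof -
  have False if u: "out \<in> UTxO B" and i: "(n, i) \<in> input_occs B" and eq: "fst i = fst out"
    for out n i
  proof -
    obtain m where m: "(m, out) \<in> output_occs B" "\<not> spent B (m, out)"
      using u by (auto simp: UTxO_def)
    obtain r where r: "r \<in> output_occs B" "fst r < n" "points_to i (snd r)"
      using assms i unfolding blockchain_def by blast
    have "r = (m, out)"
      using assms r m eq inj_onD[of "\<lambda>(m, out). fst out" "output_occs B" r "(m, out)"]
      unfolding blockchain_def points_to_def by (simp add: case_prod_unfold)
    then show False
      using r m i by (auto simp: spent_def)
  qed
  then show ?thesis
    by (fastforce simp: input_positions_def)
qed

text \<open>The witness exchanges \<open>S\<close> with a translate of itself beyond all elements of \<open>S \<union> Q\<close>.\<close>

lemma ex_involution_avoiding: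
  fixes S Q :: "nat set"
  assumes "finite S" and "finite Q"
  obtains \<pi> where "\<And>x. \<pi> (\<pi> x) = x" and "\<And>x. x \<in> Q - S \<Longrightarrow> \<pi> x = x" and "\<pi> ` S \<inter> Q = {}"
proof -
  obtain M where M: "\<And>x. x \<in> S \<union> Q \<Longrightarrow> x < M"
    using assms finite_nat_set_iff_bounded[of "S \<union> Q"] by auto
  \<comment> \<open>The guard \<open>M \<le> x\<close> matters because subtraction on
    \<open>nat\<close> truncates: if \<open>0 \<in> S\<close>, it keeps the points below
    \<open>M\<close> outside \<open>S\<close> from being sent to \<open>0\<close>.\<close>
  define \<pi> where "\<pi> x = (if x \<in> S then x + M else if M \<le> x \<and> x - M \<in> S then x - M else x)" for x
  show thesis
  proof
    show "\<pi> (\<pi> x) = x" for x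
      using M by (fastforce simp: \<pi>_def)
    show "\<pi> x = x" if "x \<in> Q - S" for x
      using that M[of x] by (auto simp: \<pi>_def)
    show "\<pi> ` S \<inter> Q = {}"
      using M by (fastforce simp: \<pi>_def)
  qed
qed

text \<open>Here \<open>B\<close> has to be a renaming of \<open>B\<^sub>1\<close>, not the
  converse. Taking \<open>\<pi>\<close> to be an involution lets the same map create
  \<open>B\<^sub>1\<close> and lead back to \<open>B\<close>.\<close>

lemma ex_alpha_equiv_avoiding:
  assumes irrelevant: "spent_positions_irrelevant Vs den"
    and B: "blockchain Vs den B"
    and P: "finite P"
  obtains B\<^sub>1 where "alpha_equiv Vs den B\<^sub>1 B" and "input_positions B\<^sub>1 \<inter> P = {}"
proof -
  have Txs: "set B \<subseteq> Transactions Vs"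
    using B by (simp add: blockchain_def)
  obtain \<pi> where inv: "\<And>x. \<pi> (\<pi> x) = x"
    and fix_pos: "\<And>x. x \<in> fst ` UTxO B \<union> P - input_positions B \<Longrightarrow> \<pi> x = x"
    and avoid: "\<pi> ` input_positions B \<inter> (fst ` UTxO B \<union> P) = {}"
    using ex_involution_avoiding[of "input_positions B" "fst ` UTxO B \<union> P"]
      finite_input_positions[OF Txs] finite_UTxO[OF Txs] P
    by (metis finite_UnI finite_imageI)
  \<comment> \<open>Unspent positions are never input positions, so \<open>fix_pos\<close> covers
    all of them.\<close>
  have ren: "spent_renaming B \<pi>"
    using fix_pos input_positions_disjoint_UTxO[OF B] inv
    unfolding spent_renaming_def by (auto intro!: o_bij[of \<pi>])
  then have "blockchain Vs den (rename \<pi> B)"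
    using irrelevant B by (auto simp: spent_positions_irrelevant_def)
  moreover have "spent_renaming (rename \<pi> B) \<pi>"
    using ren UTxO_spent_renaming[OF ren] by (simp add: spent_renaming_def)
  ultimately have "alpha_equiv Vs den (rename \<pi> B) B"
    using B rename_rename[of \<pi> \<pi>, OF inv] unfolding alpha_equiv_def by metis
  moreover have "input_positions (rename \<pi> B) \<inter> P = {}"
    using avoid by (auto simp: input_positions_rename)
  ultimately show thesis
    by (rule that)
qed

section \<open>Validity of a one-transaction extension\<close>

text \<open>The right-hand side mentions \<open>B\<close> only through \<open>UTxO B\<close>, so
  observationally equivalent blockchains satisfying \<open>fresh\<close> accept the same
  \<open>tx\<close>.\<close>

lemma blockchain_snoc_iff:
  assumes B: "blockchain Vs den B"
    and fresh: "input_positions B \<inter> tx_positions tx = {}"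
  shows "blockchain Vs den (B @ [tx]) \<longleftrightarrow>
     tx \<in> Transactions Vs \<and>
     inj_on fst (snd tx) \<and> fst ` UTxO B \<inter> fst ` snd tx = {} \<and>
     (\<forall>i\<in>fst tx. \<exists>out\<in>UTxO B. points_to i out) \<and>
     inj_on fst (fst tx) \<and>
     (\<forall>p k V s v. (p, k) \<in> fst tx \<and> (p, V, s, v) \<in> UTxO B
        \<longrightarrow> (k, s, v, tx_at tx (p, k)) \<in> den V)"
proof -
  have injB: "inj_on (\<lambda>(m, out). fst out) (output_occs B)"
    and ptrB: "\<And>n i. (n, i) \<in> input_occs B \<Longrightarrow>
      \<exists>!r. r \<in> output_occs B \<and> fst r < n \<and> points_to i (snd r)"
    and injB': "inj_on (\<lambda>(n, i). fst i) (input_occs B)"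
    using B unfolding blockchain_def by blast+
  \<comment> \<open>A spent output of \<open>B\<close> shares its position with an input of
    \<open>B\<close>, and \<open>fresh\<close> keeps such positions away from \<open>tx\<close>.
    Hence every output of \<open>B\<close> at a position of \<open>tx\<close> is unspent.\<close>
  have occ_iff: "(\<exists>m. (m, out) \<in> output_occs B) \<longleftrightarrow> out \<in> UTxO B"
    if "fst out \<in> tx_positions tx" for out
    using that fresh
    by (fastforce simp: UTxO_def spent_def points_to_def input_positions_def)
  have txs: "set (B @ [tx]) \<subseteq> Transactions Vs \<longleftrightarrow> tx \<in> Transactions Vs"
    using B by (auto simp: blockchain_def)
  have outs: "inj_on (\<lambda>(m, out). fst out) (output_occs (B @ [tx])) \<longleftrightarrow>
      inj_on fst (snd tx) \<and> fst ` UTxO B \<inter> fst ` snd tx = {}"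
  proof -
    have "inj_on (\<lambda>(m, out). fst out) ({length B} \<times> snd tx) \<longleftrightarrow> inj_on fst (snd tx)"
      by (auto simp: inj_on_def)
    moreover have "(\<lambda>(m, out). fst out) ` output_occs B \<inter> fst ` snd tx = {} \<longleftrightarrow>
        fst ` UTxO B \<inter> fst ` snd tx = {}"
    proof -
      have "p \<in> (\<lambda>(m, out). fst out) ` output_occs B \<longleftrightarrow> p \<in> fst ` UTxO B"
        if "p \<in> fst ` snd tx" for p
        using that occ_iff unfolding tx_positions_def image_iff
        by (metis (mono_tags, lifting) UnI2 case_prod_conv fst_conv image_eqI prod.collapse snd_conv)
      then show ?thesis by blast
    qed
    moreover have "(\<lambda>(m, out). fst out) ` ({length B} \<times> snd tx) = fst ` snd tx"
      by force
    \<comment> \<open>\<open>inj_on_Un\<close> compares the images of the two set differences; these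
      are the full sets because the index \<open>length B\<close> does not occur in
      \<open>B\<close>.\<close>
    moreover have "output_occs B - {length B} \<times> snd tx = output_occs B"
      "{length B} \<times> snd tx - output_occs B = {length B} \<times> snd tx"
      by (auto dest: output_occs_less)
    ultimately show ?thesis
      using injB by (simp add: output_occs_snoc inj_on_Un)
  qed
  have ins: "inj_on (\<lambda>(n, i). fst i) (input_occs (B @ [tx])) \<longleftrightarrow> inj_on fst (fst tx)"
  proof -
    have "inj_on (\<lambda>(n, i). fst i) ({length B} \<times> fst tx) \<longleftrightarrow> inj_on fst (fst tx)"
      by (auto simp: inj_on_def)
    moreover have "(\<lambda>(n, i). fst i) ` input_occs B \<inter> (\<lambda>(n, i). fst i) ` ({length B} \<times> fst tx) = {}"
      using fresh unfolding input_positions_def[symmetric] tx_positions_def by auto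
    ultimately show ?thesis
      using injB' unfolding input_occs_snoc inj_on_Un by blast
  qed
  \<comment> \<open>The case \<open>n = length B\<close> is included: an input of \<open>tx\<close>
    itself may only point to outputs of \<open>B\<close>, since \<open>fst r < n\<close> is
    strict.\<close>
  have ptr_old: "r \<in> output_occs (B @ [tx]) \<and> fst r < n \<and> points_to i (snd r) \<longleftrightarrow>
      r \<in> output_occs B \<and> fst r < n \<and> points_to i (snd r)" if "n \<le> length B" for n i r
    using that by (auto simp: output_occs_snoc)
  \<comment> \<open>Existence transfers by \<open>occ_iff\<close>; uniqueness comes from
    \<open>injB\<close>.\<close>
  have ptr_new: "(\<exists>!r. r \<in> output_occs B \<and> fst r < length B \<and> points_to i (snd r)) \<longleftrightarrow>
      (\<exists>out\<in>UTxO B. points_to i out)" if "i \<in> fst tx" for i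
  proof
    assume "\<exists>!r. r \<in> output_occs B \<and> fst r < length B \<and> points_to i (snd r)"
    then obtain m out where "(m, out) \<in> output_occs B" "points_to i out"
      by auto
    moreover have "fst out \<in> tx_positions tx"
      using \<open>points_to i out\<close> that unfolding points_to_def tx_positions_def
      by (metis UnI1 imageI)
    ultimately show "\<exists>out\<in>UTxO B. points_to i out"
      using occ_iff by blast
  next
    assume "\<exists>out\<in>UTxO B. points_to i out"
    then obtain m out where "(m, out) \<in> output_occs B" "points_to i out"
      by (auto simp: UTxO_def)
    then show "\<exists>!r. r \<in> output_occs B \<and> fst r < length B \<and> points_to i (snd r)"
      using output_occs_less[of m out B] inj_onD[OF injB, of _ "(m, out)"]
      by (intro ex1I[of _ "(m, out)"]) (simp_all add: points_to_def case_prod_unfold)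
  qed
  have ptrs: "(\<forall>(n, i)\<in>input_occs (B @ [tx]).
        \<exists>!r. r \<in> output_occs (B @ [tx]) \<and> fst r < n \<and> points_to i (snd r)) \<longleftrightarrow>
      (\<forall>i\<in>fst tx. \<exists>out\<in>UTxO B. points_to i out)" (is "?L \<longleftrightarrow> ?R")
  proof -
    have "n \<le> length B" if "(n, i) \<in> input_occs (B @ [tx])" for n i
      using input_occs_less[OF that] by simp
    then have "?L \<longleftrightarrow> (\<forall>(n, i)\<in>input_occs B \<union> {length B} \<times> fst tx.
        \<exists>!r. r \<in> output_occs B \<and> fst r < n \<and> points_to i (snd r))"
      unfolding input_occs_snoc[symmetric]
      by (intro ball_cong refl) (simp only: ptr_old split_paired_all case_prod_conv)
    also have "\<dots> \<longleftrightarrow> (\<forall>i\<in>fst tx.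
        \<exists>!r. r \<in> output_occs B \<and> fst r < length B \<and> points_to i (snd r))"
      using ptrB by blast
    also have "\<dots> \<longleftrightarrow> ?R"
      using ptr_new by (intro ball_cong) auto
    finally show ?thesis .
  qed
  have vals: "(\<forall>n p k m V s v.
        (n, (p, k)) \<in> input_occs (B @ [tx]) \<and> (m, (p, V, s, v)) \<in> output_occs (B @ [tx]) \<and> m < n
        \<longrightarrow> (k, s, v, tx_at ((B @ [tx]) ! n) (p, k)) \<in> den V) \<longleftrightarrow>
      (\<forall>p k V s v. (p, k) \<in> fst tx \<and> (p, V, s, v) \<in> UTxO B
        \<longrightarrow> (k, s, v, tx_at tx (p, k)) \<in> den V)" (is "?L \<longleftrightarrow> ?R")
  proof
    assume L: ?L
    show ?R
    proof (intro allI impI)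
      fix p k V s v
      assume pk: "(p, k) \<in> fst tx \<and> (p, V, s, v) \<in> UTxO B"
      then obtain m where "(m, (p, V, s, v)) \<in> output_occs B"
        by (auto simp: UTxO_def)
      then show "(k, s, v, tx_at tx (p, k)) \<in> den V"
        using L[rule_format, of "length B" p k m V s v] pk
        by (auto simp: input_occs_snoc output_occs_snoc dest: output_occs_less)
    qed
  next
    assume R: ?R
    show ?L
    proof (intro allI impI)
      fix n p k m V s v
      assume *: "(n, (p, k)) \<in> input_occs (B @ [tx]) \<and>
        (m, (p, V, s, v)) \<in> output_occs (B @ [tx]) \<and> m < n"
      then have out: "(m, (p, V, s, v)) \<in> output_occs B"
        by (auto simp: input_occs_snoc output_occs_snoc dest: input_occs_less)
      show "(k, s, v, tx_at ((B @ [tx]) ! n) (p, k)) \<in> den V"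
      \<comment> \<open>An input of \<open>B\<close> keeps its context, so its check is inherited
        from \<open>B\<close>; for an input of \<open>tx\<close>, \<open>occ_iff\<close> turns the
        output pointed to into an unspent one, to which \<open>R\<close> applies.\<close>
      proof (cases "n < length B")
        case True
        then have "(n, (p, k)) \<in> input_occs B"
          using * by (auto simp: input_occs_snoc)
        then have "(k, s, v, tx_at (B ! n) (p, k)) \<in> den V"
          using B out * unfolding blockchain_def by blast
        then show ?thesis
          using True by (simp add: nth_append)
      next
        case False
        then have n: "n = length B" "(p, k) \<in> fst tx"
          using * by (auto simp: input_occs_snoc dest: input_occs_less)
        then have "p \<in> tx_positions tx"
          by (force simp: tx_positions_def)
        then have "(p, V, s, v) \<in> UTxO B"
          using occ_iff[of "(p, V, s, v)"] out by auto
        then show ?thesis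
          using R n by simp
      qed
    qed
  qed
  show ?thesis
    unfolding blockchain_def[of Vs den "B @ [tx]"] txs outs ins ptrs vals by blast
qed

theorem lemma2p21:
  fixes Vs :: "'v set"
    and den :: "'v \<Rightarrow> (redeemer \<times> datum \<times> chip_value \<times> 'v tx_context) set"
    and B B' :: "'v transaction list"
    and tx :: "'v transaction"
  assumes "eutxo_solution Vs den"
    and "spent_positions_irrelevant Vs den"
    and "blockchain Vs den B"
    and "blockchain Vs den B'"
    and "tx \<in> Transactions Vs"
  shows "(B \<cong>\<^sub>U B' \<and> blockchain Vs den (B @ [tx]) \<and> blockchain Vs den (B' @ [tx])
            \<longrightarrow> B @ [tx] \<cong>\<^sub>U B' @ [tx])
       \<and> (alpha_equiv Vs den B B' \<longrightarrow> B \<cong>\<^sub>U B')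
       \<and> (\<exists>B\<^sub>1 B\<^sub>1'. alpha_equiv Vs den B\<^sub>1 B \<and> alpha_equiv Vs den B\<^sub>1' B' \<and>
            (B\<^sub>1 \<cong>\<^sub>U B\<^sub>1' \<longrightarrow>
              (blockchain Vs den (B\<^sub>1 @ [tx]) \<longleftrightarrow> blockchain Vs den (B\<^sub>1' @ [tx]))))
       \<and> (\<exists>B\<^sub>1 B\<^sub>1'. alpha_equiv Vs den B\<^sub>1 B \<and> alpha_equiv Vs den B\<^sub>1' B' \<and>
            (B\<^sub>1 \<cong>\<^sub>U B\<^sub>1' \<and> blockchain Vs den (B\<^sub>1 @ [tx])
              \<longrightarrow> B\<^sub>1 @ [tx] \<cong>\<^sub>U B\<^sub>1' @ [tx]))"
proof (intro conjI impI)
  show "B @ [tx] \<cong>\<^sub>U B' @ [tx]"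
    if "B \<cong>\<^sub>U B' \<and> blockchain Vs den (B @ [tx]) \<and> blockchain Vs den (B' @ [tx])"
    using that by (simp add: obs_equiv_snoc)
  show "B \<cong>\<^sub>U B'" if "alpha_equiv Vs den B B'"
    using that by (rule alpha_equiv_imp_obs_equiv)
  have "finite (tx_positions tx)"
    using assms(5) by (auto simp: tx_positions_def Transactions_def)
  \<comment> \<open>One pair of chains witnesses both (3) and (4). As \<alpha>-equivalence preserves
    \<open>UTxO\<close>, it satisfies \<open>B\<^sub>1 \<cong>\<^sub>U B\<^sub>1'\<close> exactly
    when \<open>B \<cong>\<^sub>U B'\<close>, so the implications are not made vacuous by the
    choice.\<close>
  then obtain B\<^sub>1 B\<^sub>1' where B\<^sub>1: "alpha_equiv Vs den B\<^sub>1 B" "input_positions B\<^sub>1 \<inter> tx_positions tx = {}"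
    and B\<^sub>1': "alpha_equiv Vs den B\<^sub>1' B'" "input_positions B\<^sub>1' \<inter> tx_positions tx = {}"
    using ex_alpha_equiv_avoiding[OF assms(2)] assms(3,4) by metis
  have "blockchain Vs den (B\<^sub>1 @ [tx]) \<longleftrightarrow> blockchain Vs den (B\<^sub>1' @ [tx])" if "B\<^sub>1 \<cong>\<^sub>U B\<^sub>1'"
    using that B\<^sub>1 B\<^sub>1' blockchain_snoc_iff[of Vs den B\<^sub>1 tx] blockchain_snoc_iff[of Vs den B\<^sub>1' tx]
    by (simp add: alpha_equiv_def obs_equiv_def)
  then show "\<exists>B\<^sub>1 B\<^sub>1'. alpha_equiv Vs den B\<^sub>1 B \<and> alpha_equiv Vs den B\<^sub>1' B' \<and>
      (B\<^sub>1 \<cong>\<^sub>U B\<^sub>1' \<longrightarrow>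
        (blockchain Vs den (B\<^sub>1 @ [tx]) \<longleftrightarrow> blockchain Vs den (B\<^sub>1' @ [tx])))"
    using B\<^sub>1(1) B\<^sub>1'(1) by blast
  show "\<exists>B\<^sub>1 B\<^sub>1'. alpha_equiv Vs den B\<^sub>1 B \<and> alpha_equiv Vs den B\<^sub>1' B' \<and>
      (B\<^sub>1 \<cong>\<^sub>U B\<^sub>1' \<and> blockchain Vs den (B\<^sub>1 @ [tx]) \<longrightarrow> B\<^sub>1 @ [tx] \<cong>\<^sub>U B\<^sub>1' @ [tx])"
    using B\<^sub>1(1) B\<^sub>1'(1) obs_equiv_snoc by blast
qed

end
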